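(* There is a monoidal natural transformation $\mathsf{superg}\colon\mathsf{Conc}\Rightarrow\mathsf{NDD}$ whose component at a finite set $N$, $\mathsf{superg}_N\colon\mathsf{Conc}(N)\to\mathsf{NDD}(N)$, is defined by $\mathsf{superg}_N(f)=\partial f$, where $\partial f$ is the superdifferential of $f$.
   Context: $(\mathbf{FinSet},+)$ is finite sets with disjoint union as monoidal product; $(\mathbf{Set},\times)$ is sets with Cartesian product. For a finite set $N$, $\mathbb{R}^N$ is the vector space of functions $N\to\mathbb{R}$. For $\phi\colon N\to M$, $\phi^*\colon\mathbb{R}^M\to\mathbb{R}^N$ is $\phi^*(y)_i=y_{\phi(i)}$ and $\phi_*\colon\mathbb{R}^N\to\mathbb{R}^M$ is $\phi_*(x)_j=\sum_{i\in\phi^{-1}(j)}x_i$. $\iota_N,\iota_M$ are the inclusions of $N,M$ into $N+M$. $P$ is the covariant powerset functor ($P(f)(A)$ is the image of $A$ under $f$). $A\boxplus B=\{a+b\mid a\in A,b\in B\}$ is the Minkowski sum, applied pointwise to set-valued functions. For concave $f\colon\mathbb{R}^N\to\mathbb{R}$, the superdifferential $\partial f(x)$ is the set of $w\in\mathbb{R}^N$ with $f(y)-f(x)\le w^T(y-x)$ for all $y\in\mathbb{R}^N$. $\mathsf{Conc}\colon(\mathbf{FinSet},+)\to(\mathbf{Set},\times)$ is the lax symmetric monoidal functor with $\mathsf{Conc}(N)$ the set of concave functions $f\colon\mathbb{R}^N\to\mathbb{R}$ (not necessarily differentiable); $\mathsf{Conc}(\phi)(f)=f\circ\phi^*$; product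 comparison $(f,g)\mapsto f\circ\iota_N^*+g\circ\iota_M^*$; unit comparison picking the zero function on $\mathbb{R}^0$. $\mathsf{NDD}\colon(\mathbf{FinSet},+)\to(\mathbf{Set},\times)$ is the lax symmetric monoidal functor with $\mathsf{NDD}(N)$ the set of functions $\mathbb{R}^N\to P\mathbb{R}^N$; $\mathsf{NDD}(\phi)(\upsilon)=P\phi_*\circ\upsilon\circ\phi^*$; product comparison $(\upsilon,\rho)\mapsto(P\iota_{N*}\circ\upsilon\circ\iota_N^* )\boxplus(P\iota_{M*}\circ\rho\circ\iota_M^* )$; unit comparison picking the function $0\mapsto\{0\}$ on $\mathbb{R}^0$. *)

theory Defs
  imports
    "HOL-Analysis.Analysis"
    "HOL-Library.Function_Algebras"
    "HOL-Library.Set_Algebras"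
begin

section \<open>The symmetric monoidal category of finite sets\<close>

text \<open>
  A functor has to act on all finite sets at once, so these must live in a single type that is
  closed under disjoint union. The type of elements below is freely generated by an arbitrary
  type of atoms under two injections; every finite set of atoms, of any type, is an object.
  The monoidal unit is the empty set.
\<close>

datatype 'a elt = Atom 'a | Lft "'a elt" | Rgt "'a elt"

definition coprod :: "'a elt set \<Rightarrow> 'a elt set \<Rightarrow> 'a elt set" (infixr \<open>\<^bold>+\<close> 65)
  where "N \<^bold>+ M = Lft ` N \<union> Rgt ` M"

text \<open>Morphisms from \<open>N\<close> to \<open>M\<close> are the elements of \<open>N \<rightarrow>\<^sub>E M\<close>, with composition
  \<open>compose N\<close> and identity \<open>restrict id N\<close>.\<close>

fun copair :: "('a elt \<Rightarrow> 'b) \<Rightarrow> ('a elt \<Rightarrow> 'b) \<Rightarrow> 'a elt \<Rightarrow> 'b" where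
  "copair f g (Lft n) = f n"
| "copair f g (Rgt m) = g m"
| "copair f g (Atom a) = undefined"

definition incl_left :: "'a elt set \<Rightarrow> 'a elt \<Rightarrow> 'a elt"
  where "incl_left N = restrict Lft N"

definition incl_right :: "'a elt set \<Rightarrow> 'a elt \<Rightarrow> 'a elt"
  where "incl_right M = restrict Rgt M"

definition coprod_map ::
  "'a elt set \<Rightarrow> 'a elt set \<Rightarrow> ('a elt \<Rightarrow> 'a elt) \<Rightarrow> ('a elt \<Rightarrow> 'a elt) \<Rightarrow> 'a elt \<Rightarrow> 'a elt"
  where "coprod_map N M \<phi> \<psi> = restrict (copair (Lft \<circ> \<phi>) (Rgt \<circ> \<psi>)) (N \<^bold>+ M)"

definition associator :: "'a elt set \<Rightarrow> 'a elt set \<Rightarrow> 'a elt set \<Rightarrow> 'a elt \<Rightarrow> 'a elt"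
  where "associator N M K =
    restrict (copair (copair Lft (Rgt \<circ> Lft)) (Rgt \<circ> Rgt)) ((N \<^bold>+ M) \<^bold>+ K)"

definition left_unitor :: "'a elt set \<Rightarrow> 'a elt \<Rightarrow> 'a elt"
  where "left_unitor N = restrict (copair id id) ({} \<^bold>+ N)"

definition right_unitor :: "'a elt set \<Rightarrow> 'a elt \<Rightarrow> 'a elt"
  where "right_unitor N = restrict (copair id id) (N \<^bold>+ {})"

definition braiding :: "'a elt set \<Rightarrow> 'a elt set \<Rightarrow> 'a elt \<Rightarrow> 'a elt"
  where "braiding N M = restrict (copair Rgt Lft) (N \<^bold>+ M)"


section \<open>Lax symmetric monoidal functors to sets and their transformations\<close>

text \<open>
  The sets \<open>Obj F N\<close> are subsets of a common type \<open>'x\<close>, which may differ from functor to functor.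
  The product of sets is the Cartesian product and its unit is the one-point type \<open>unit\<close>.
  Maps out of \<open>Obj F N\<close> only matter on \<open>Obj F N\<close>, so equations between them are stated
  elementwise.
\<close>

record ('a, 'x) set_functor =
  Obj :: "'a elt set \<Rightarrow> 'x set"
  Map :: "'a elt set \<Rightarrow> 'a elt set \<Rightarrow> ('a elt \<Rightarrow> 'a elt) \<Rightarrow> 'x \<Rightarrow> 'x"
  Prod_comp :: "'a elt set \<Rightarrow> 'a elt set \<Rightarrow> 'x \<times> 'x \<Rightarrow> 'x"
  Unit_comp :: "unit \<Rightarrow> 'x"

definition is_functor :: "('a, 'x) set_functor \<Rightarrow> bool"
  where "is_functor F \<longleftrightarrow>
    (\<forall>N M \<phi>. finite N \<longrightarrow> finite M \<longrightarrow> \<phi> \<in> N \<rightarrow>\<^sub>E M \<longrightarrow> Map F N M \<phi> \<in> Obj F N \<rightarrow> Obj F M) \<and>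
    (\<forall>N. finite N \<longrightarrow> (\<forall>x\<in>Obj F N. Map F N N (restrict id N) x = x)) \<and>
    (\<forall>N M K \<phi> \<psi>. finite N \<longrightarrow> finite M \<longrightarrow> finite K \<longrightarrow> \<phi> \<in> N \<rightarrow>\<^sub>E M \<longrightarrow> \<psi> \<in> M \<rightarrow>\<^sub>E K \<longrightarrow>
      (\<forall>x\<in>Obj F N. Map F N K (compose N \<psi> \<phi>) x = Map F M K \<psi> (Map F N M \<phi> x)))"

definition lax_symmetric_monoidal_functor :: "('a, 'x) set_functor \<Rightarrow> bool"
  where "lax_symmetric_monoidal_functor F \<longleftrightarrow>
    is_functor F \<and>
    (\<forall>N M. finite N \<longrightarrow> finite M \<longrightarrow> Prod_comp F N M \<in> Obj F N \<times> Obj F M \<rightarrow> Obj F (N \<^bold>+ M)) \<and>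
    Unit_comp F \<in> UNIV \<rightarrow> Obj F {} \<and>
    \<comment> \<open>naturality of the product comparison\<close>
    (\<forall>N N' M M' \<phi> \<psi>. finite N \<longrightarrow> finite N' \<longrightarrow> finite M \<longrightarrow> finite M' \<longrightarrow>
      \<phi> \<in> N \<rightarrow>\<^sub>E N' \<longrightarrow> \<psi> \<in> M \<rightarrow>\<^sub>E M' \<longrightarrow>
      (\<forall>x\<in>Obj F N. \<forall>y\<in>Obj F M.
        Map F (N \<^bold>+ M) (N' \<^bold>+ M') (coprod_map N M \<phi> \<psi>) (Prod_comp F N M (x, y)) =
        Prod_comp F N' M' (Map F N N' \<phi> x, Map F M M' \<psi> y))) \<and>
    \<comment> \<open>associativity\<close>
    (\<forall>N M K. finite N \<longrightarrow> finite M \<longrightarrow> finite K \<longrightarrow>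
      (\<forall>x\<in>Obj F N. \<forall>y\<in>Obj F M. \<forall>z\<in>Obj F K.
        Map F ((N \<^bold>+ M) \<^bold>+ K) (N \<^bold>+ (M \<^bold>+ K)) (associator N M K)
          (Prod_comp F (N \<^bold>+ M) K (Prod_comp F N M (x, y), z)) =
        Prod_comp F N (M \<^bold>+ K) (x, Prod_comp F M K (y, z)))) \<and>
    \<comment> \<open>unitality\<close>
    (\<forall>N. finite N \<longrightarrow> (\<forall>x\<in>Obj F N.
      Map F ({} \<^bold>+ N) N (left_unitor N) (Prod_comp F {} N (Unit_comp F (), x)) = x \<and>
      Map F (N \<^bold>+ {}) N (right_unitor N) (Prod_comp F N {} (x, Unit_comp F ())) = x)) \<and>
    \<comment> \<open>symmetry\<close>
    (\<forall>N M. finite N \<longrightarrow> finite M \<longrightarrow> (\<forall>x\<in>Obj F N. \<forall>y\<in>Obj F M.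
      Map F (N \<^bold>+ M) (M \<^bold>+ N) (braiding N M) (Prod_comp F N M (x, y)) =
      Prod_comp F M N (y, x)))"

definition natural_transformation ::
  "('a, 'x) set_functor \<Rightarrow> ('a, 'y) set_functor \<Rightarrow> ('a elt set \<Rightarrow> 'x \<Rightarrow> 'y) \<Rightarrow> bool"
  where "natural_transformation F G \<eta> \<longleftrightarrow>
    is_functor F \<and> is_functor G \<and>
    (\<forall>N. finite N \<longrightarrow> \<eta> N \<in> Obj F N \<rightarrow> Obj G N) \<and>
    (\<forall>N M \<phi>. finite N \<longrightarrow> finite M \<longrightarrow> \<phi> \<in> N \<rightarrow>\<^sub>E M \<longrightarrow>
      (\<forall>x\<in>Obj F N. \<eta> M (Map F N M \<phi> x) = Map G N M \<phi> (\<eta> N x)))"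

definition monoidal_natural_transformation ::
  "('a, 'x) set_functor \<Rightarrow> ('a, 'y) set_functor \<Rightarrow> ('a elt set \<Rightarrow> 'x \<Rightarrow> 'y) \<Rightarrow> bool"
  where "monoidal_natural_transformation F G \<eta> \<longleftrightarrow>
    lax_symmetric_monoidal_functor F \<and> lax_symmetric_monoidal_functor G \<and>
    natural_transformation F G \<eta> \<and>
    (\<forall>N M. finite N \<longrightarrow> finite M \<longrightarrow> (\<forall>x\<in>Obj F N. \<forall>y\<in>Obj F M.
      \<eta> (N \<^bold>+ M) (Prod_comp F N M (x, y)) = Prod_comp G N M (\<eta> N x, \<eta> M y))) \<and>
    \<eta> {} (Unit_comp F ()) = Unit_comp G ()"


section \<open>The vector spaces of real functions on a finite set\<close>

instantiation "fun" :: (type, real_vector) real_vector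
begin

definition scaleR_fun :: "real \<Rightarrow> ('a \<Rightarrow> 'b) \<Rightarrow> 'a \<Rightarrow> 'b"
  where "scaleR_fun c x = (\<lambda>i. c *\<^sub>R x i)"

instance
  by standard (simp_all add: scaleR_fun_def fun_eq_iff plus_fun_def scaleR_add_left scaleR_add_right)

end

text \<open>Functions on \<open>N\<close> are extended by \<open>0\<close>, so that they form a subspace of the
  vector space of all functions.\<close>

definition vec_space :: "'i set \<Rightarrow> ('i \<Rightarrow> real) set"  (\<open>\<real>\<^bsup>_\<^esup>\<close>)
  where "\<real>\<^bsup>N\<^esup> = {x. \<forall>i. i \<notin> N \<longrightarrow> x i = 0}"

definition pullback :: "'i set \<Rightarrow> ('i \<Rightarrow> 'j) \<Rightarrow> ('j \<Rightarrow> real) \<Rightarrow> 'i \<Rightarrow> real"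
  where "pullback N \<phi> y = (\<lambda>i. if i \<in> N then y (\<phi> i) else 0)"

definition pushforward :: "'i set \<Rightarrow> ('i \<Rightarrow> 'j) \<Rightarrow> ('i \<Rightarrow> real) \<Rightarrow> 'j \<Rightarrow> real"
  where "pushforward N \<phi> x = (\<lambda>j. \<Sum>i\<in>{i\<in>N. \<phi> i = j}. x i)"

definition superdifferential ::
  "'i set \<Rightarrow> (('i \<Rightarrow> real) \<Rightarrow> real) \<Rightarrow> ('i \<Rightarrow> real) \<Rightarrow> ('i \<Rightarrow> real) set"
  where "superdifferential N f x =
    {w \<in> \<real>\<^bsup>N\<^esup>. \<forall>y\<in>\<real>\<^bsup>N\<^esup>. f y - f x \<le> (\<Sum>i\<in>N. w i * (y i - x i))}"


section \<open>The two functors and the transformation between them\<close>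

definition Conc :: "('a, ('a elt \<Rightarrow> real) \<Rightarrow> real) set_functor"
  where "Conc = \<lparr>
    Obj = (\<lambda>N. {f \<in> \<real>\<^bsup>N\<^esup> \<rightarrow>\<^sub>E UNIV. concave_on (\<real>\<^bsup>N\<^esup>) f}),
    Map = (\<lambda>N M \<phi> f. \<lambda>y\<in>\<real>\<^bsup>M\<^esup>. f (pullback N \<phi> y)),
    Prod_comp = (\<lambda>N M (f, g). \<lambda>z\<in>\<real>\<^bsup>N \<^bold>+ M\<^esup>.
      f (pullback N (incl_left N) z) + g (pullback M (incl_right M) z)),
    Unit_comp = (\<lambda>_. \<lambda>z\<in>\<real>\<^bsup>{}\<^esup>. 0)\<rparr>"

text \<open>Below, \<open>+\<close> on sets of functions is the Minkowski sum from \<open>Set_Algebras\<close>.\<close>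

definition NDD :: "('a, ('a elt \<Rightarrow> real) \<Rightarrow> ('a elt \<Rightarrow> real) set) set_functor"
  where "NDD = \<lparr>
    Obj = (\<lambda>N. \<real>\<^bsup>N\<^esup> \<rightarrow>\<^sub>E Pow (\<real>\<^bsup>N\<^esup>)),
    Map = (\<lambda>N M \<phi> \<upsilon>. \<lambda>y\<in>\<real>\<^bsup>M\<^esup>. pushforward N \<phi> ` \<upsilon> (pullback N \<phi> y)),
    Prod_comp = (\<lambda>N M (\<upsilon>, \<rho>). \<lambda>z\<in>\<real>\<^bsup>N \<^bold>+ M\<^esup>.
      pushforward N (incl_left N) ` \<upsilon> (pullback N (incl_left N) z) +
      pushforward M (incl_right M) ` \<rho> (pullback M (incl_right M) z)),
    Unit_comp = (\<lambda>_. \<lambda>z\<in>\<real>\<^bsup>{}\<^esup>. {0})\<rparr>"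

definition superg ::
  "'a elt set \<Rightarrow> (('a elt \<Rightarrow> real) \<Rightarrow> real) \<Rightarrow> ('a elt \<Rightarrow> real) \<Rightarrow> ('a elt \<Rightarrow> real) set"
  where "superg N f = (\<lambda>x\<in>\<real>\<^bsup>N\<^esup>. superdifferential N f x)"

end

theory Submission
  imports Defs
begin

text \<open>
  The substance of the theorem is that superdifferentials obey two rules of calculus.

  Naturality is the chain rule \<open>\<partial>(f \<circ> \<phi>\<^sup>*)(y) = \<phi>\<^sub>* ` \<partial>f (\<phi>\<^sup>* y)\<close>, proved as \<open>superdifferential_pullback\<close>.
  Since \<open>\<phi>\<^sub>*\<close> is the transpose of \<open>\<phi>\<^sup>*\<close>, the inclusion from right to left is immediate. For the other
  one, a supergradient \<open>w\<close> of \<open>f \<circ> \<phi>\<^sup>*\<close> bounds increments of \<open>f\<close> only along the range of \<open>\<phi>\<^sup>*\<close>, that is,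
  along vectors that are constant on the fibres of \<open>\<phi>\<close>. It defines a linear functional on this range,
  because \<open>w\<close> has no component outside the image of \<open>\<phi>\<close>; and \<open>f\<close> being concave and finite everywhere,
  the functional extends to all of \<open>\<real>\<^bsup>N\<^esup>\<close> as a supergradient of \<open>f\<close> by a finite-dimensional
  Hahn-Banach argument (\<open>concave_dominated_extension\<close>).

  Compatibility with the product comparisons is the rule that the supergradients of a sum of two
  functions of separate variables are the pairs of supergradients (\<open>superdifferential_coprod\<close>). A
  supergradient of the sum splits by varying one group of variables at a time.

  The coherence conditions for the two functors reduce to identities between maps of finite sets,
  because pullback and pushforward are functorial and linear.
\<close>

section \<open>Extending a linear functional that dominates a concave function\<close>

text \<open>
  A basis of \<open>S\<close> stays independent when \<open>a\<close> is added, so the values on it can be chosen freely.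
  Functionals are kept defined on the whole space, and only their restrictions to subspaces matter.
\<close>

lemma linear_functional_with_prescribed_value:
  fixes l :: "'v::real_vector \<Rightarrow> real"
  assumes S: "subspace S" and l: "linear l" and a: "a \<notin> S"
  obtains l' where "linear l'" "\<And>x. x \<in> S \<Longrightarrow> l' x = l x" "l' a = c"
proof -
  obtain B where B: "B \<subseteq> S" "independent B" "S \<subseteq> span B"
    using maximal_independent_subset by blast
  have "span B = S"
    using B S by (simp add: span_minimal subset_antisym)
  with B a have "independent (insert a B)"
    by (simp add: independent_insertI)
  then obtain l' where l': "linear l'" "\<forall>b\<in>insert a B. l' b = (l(a := c)) b"
    using linear_independent_extend by blast
  have "l' b = l b" if "b \<in> B" for b
    using that l'(2) a B(1) by auto
  then have "l' x = l x" if "x \<in> S" for x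
    using linear_eq_on_span[OF l'(1) l] B(3) that by blast
  with l' show thesis by (auto intro: that)
qed

text \<open>
  The value \<open>c\<close> of the extension at \<open>a\<close> must satisfy \<open>g (x + t a) \<le> l x + t c\<close> for all \<open>x \<in> S\<close> and all
  real \<open>t\<close>. Positive \<open>t\<close> give lower bounds for \<open>c\<close> and negative \<open>t\<close> give upper bounds. A lower bound
  never exceeds an upper bound: for the points \<open>x + t a\<close> and \<open>y - s a\<close>, the convex combination with
  weights \<open>s / (s + t)\<close> and \<open>t / (s + t)\<close> lies in \<open>S\<close>, where \<open>g \<le> l\<close>, and \<open>g\<close> is concave.
\<close>

lemma concave_dominated_extension_step:
  fixes g l :: "'v::real_vector \<Rightarrow> real"
  assumes S: "subspace S" and g: "concave_on (span (insert a S)) g"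
    and l: "linear l" and le: "\<And>x. x \<in> S \<Longrightarrow> g x \<le> l x"
  obtains l' where "linear l'" "\<And>x. x \<in> S \<Longrightarrow> l' x = l x"
    "\<And>x. x \<in> span (insert a S) \<Longrightarrow> g x \<le> l' x"
proof (cases "a \<in> S")
  case True
  then have "span (insert a S) = S"
    using S by (simp add: insert_absorb)
  with l le show thesis by (auto intro: that)
next
  case False
  \<comment> \<open>the lower and the upper bounds that the value at \<open>a\<close> has to respect\<close>
  define L where "L = (\<lambda>(x, t). (g (x + t *\<^sub>R a) - l x) / t) ` (S \<times> {0<..})"
  define U where "U = (\<lambda>(x, s). (l x - g (x - s *\<^sub>R a)) / s) ` (S \<times> {0<..})"
  have mem: "x + t *\<^sub>R a \<in> span (insert a S)" if "x \<in> S" for x t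
    using that by (simp add: span_add span_base span_scale)
  have LU: "p \<le> q" if pq: "p \<in> L" "q \<in> U" for p q
  proof -
    obtain x t y s where x: "x \<in> S" "t > 0" "p = (g (x + t *\<^sub>R a) - l x) / t"
      and y: "y \<in> S" "s > 0" "q = (l y - g (y - s *\<^sub>R a)) / s"
      using pq unfolding L_def U_def by force
    define u v where "u = s / (s + t)" and "v = t / (s + t)"
    have uv: "u \<ge> 0" "v \<ge> 0" "u + v = 1"
      using x(2) y(2) by (auto simp: u_def v_def add_divide_distrib[symmetric])
    have z: "u *\<^sub>R x + v *\<^sub>R y \<in> S"
      using S x(1) y(1) by (simp add: subspace_add subspace_scale)
    have "u *\<^sub>R (x + t *\<^sub>R a) + v *\<^sub>R (y - s *\<^sub>R a) = u *\<^sub>R x + v *\<^sub>R y"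
      by (simp add: u_def v_def algebra_simps)
    moreover have "y - s *\<^sub>R a \<in> span (insert a S)"
      using mem[OF y(1), of "- s"] by simp
    ultimately have "u * g (x + t *\<^sub>R a) + v * g (y - s *\<^sub>R a) \<le> g (u *\<^sub>R x + v *\<^sub>R y)"
      using g mem[OF x(1), of t] uv unfolding concave_on_iff by metis
    also have "\<dots> \<le> u * l x + v * l y"
      using le[OF z] by (simp add: linear_add[OF l] linear_scale[OF l])
    finally have "u * (g (x + t *\<^sub>R a) - l x) \<le> v * (l y - g (y - s *\<^sub>R a))"
      by (simp add: algebra_simps)
    then have "(s + t) * (u * (g (x + t *\<^sub>R a) - l x)) \<le> (s + t) * (v * (l y - g (y - s *\<^sub>R a)))"
      using x(2) y(2) by (intro mult_left_mono) auto
    then have "s * (g (x + t *\<^sub>R a) - l x) \<le> t * (l y - g (y - s *\<^sub>R a))"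
      using x(2) y(2) by (simp add: u_def v_def)
    then have "(s * t) * p \<le> (s * t) * q"
      using x(2) y(2) by (simp add: x(3) y(3))
    then show "p \<le> q"
      using x(2) y(2) by simp
  qed
  have "0 \<in> S" using S by (rule subspace_0)
  then have ne: "L \<noteq> {}" "U \<noteq> {}"
    by (auto simp: L_def U_def intro!: exI[of _ 0] exI[of _ 1])
  define c where "c = Sup L"
  have "bdd_above L"
    using ne(2) LU by (meson bdd_aboveI ex_in_conv)
  then have Lc: "p \<le> c" if "p \<in> L" for p
    unfolding c_def using that by (simp add: cSup_upper)
  have cU: "c \<le> q" if "q \<in> U" for q
    unfolding c_def using that LU ne(1) by (meson cSup_least)
  obtain l' where l': "linear l'" "\<And>x. x \<in> S \<Longrightarrow> l' x = l x" "l' a = c"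
    using linear_functional_with_prescribed_value[OF S l False] by metis
  have "g z \<le> l' z" if z: "z \<in> span (insert a S)" for z
  proof -
    obtain t where "z - t *\<^sub>R a \<in> span S"
      using z by (auto simp: span_breakdown_eq)
    define x where "x = z - t *\<^sub>R a"
    have x: "x \<in> S" "z = x + t *\<^sub>R a"
      using \<open>z - t *\<^sub>R a \<in> span S\<close> S unfolding x_def by (metis span_eq_iff, simp)
    have l'z: "l' z = l x + t * c"
      using x l' by (simp add: linear_add linear_scale)
    consider "t = 0" | "t > 0" | "t < 0" by linarith
    then show ?thesis
    proof cases
      case 1
      then show ?thesis using x le l'z by simp
    next
      case 2
      then have "(g z - l x) / t \<le> c"
        using x by (intro Lc) (auto simp: L_def intro!: rev_image_eqI[of "(x, t)"])
      then show ?thesis using 2 l'z by (simp add: field_simps)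
    next
      case 3
      then have "c \<le> (l x - g z) / (- t)"
        using x by (intro cU) (auto simp: U_def intro!: rev_image_eqI[of "(x, - t)"])
      then show ?thesis using 3 l'z by (simp add: field_simps)
    qed
  qed
  with l' show thesis by (auto intro: that)
qed

text \<open>
  The Hahn-Banach theorem for a concave minorant. Only finitely many directions are missing from \<open>S\<close>,
  so adding them one at a time suffices.
\<close>

lemma concave_dominated_extension:
  fixes g l :: "'v::real_vector \<Rightarrow> real"
  assumes B: "finite B" and S: "subspace S" and g: "concave_on (span (B \<union> S)) g"
    and l: "linear l" and le: "\<And>x. x \<in> S \<Longrightarrow> g x \<le> l x"
  shows "\<exists>l'. linear l' \<and> (\<forall>x\<in>S. l' x = l x) \<and> (\<forall>x\<in>span (B \<union> S). g x \<le> l' x)"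
  using B g
proof (induction B rule: finite_induct)
  case empty
  have "span S = S"
    using S by simp
  with l le show ?case by (metis Un_empty_left)
next
  case (insert b B)
  have sub: "span (B \<union> S) \<subseteq> span (insert b B \<union> S)"
    by (rule span_mono) auto
  have sp: "span (insert b (span (B \<union> S))) = span (insert b B \<union> S)"
  proof
    show "span (insert b (span (B \<union> S))) \<subseteq> span (insert b B \<union> S)"
      using sub by (intro span_minimal) (auto simp: span_base)
    show "span (insert b B \<union> S) \<subseteq> span (insert b (span (B \<union> S)))"
      by (intro span_mono) (auto simp: span_base)
  qed
  have "concave_on (span (B \<union> S)) g"
    using insert.prems sub subspace_imp_convex[OF subspace_span]
    unfolding concave_on_def by (rule convex_on_subset)
  then obtain l1 where l1: "linear l1" "\<forall>x\<in>S. l1 x = l x" "\<forall>x\<in>span (B \<union> S). g x \<le> l1 x"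
    using insert.IH by blast
  have "concave_on (span (insert b (span (B \<union> S)))) g"
    using insert.prems sp by simp
  then obtain l2 where l2: "linear l2" "\<And>x. x \<in> span (B \<union> S) \<Longrightarrow> l2 x = l1 x"
    "\<And>x. x \<in> span (insert b (span (B \<union> S))) \<Longrightarrow> g x \<le> l2 x"
    using concave_dominated_extension_step[OF subspace_span _ l1(1)] l1(3) by metis
  have "l2 x = l x" if "x \<in> S" for x
    using that l2(2)[of x] l1(2) by (simp add: span_base)
  with l2 show ?case unfolding sp by blast
qed


section \<open>Pullback and pushforward\<close>

lemma zero_in_vec_space [simp]: "0 \<in> \<real>\<^bsup>N\<^esup>"
  by (simp add: vec_space_def)

lemma subspace_vec_space: "subspace \<real>\<^bsup>N\<^esup>"
  by (simp add: subspace_def vec_space_def scaleR_fun_def)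

lemma vec_space_add [simp]: "x \<in> \<real>\<^bsup>N\<^esup> \<Longrightarrow> y \<in> \<real>\<^bsup>N\<^esup> \<Longrightarrow> x + y \<in> \<real>\<^bsup>N\<^esup>"
  by (rule subspace_add[OF subspace_vec_space])

lemma vec_space_diff [simp]: "x \<in> \<real>\<^bsup>N\<^esup> \<Longrightarrow> y \<in> \<real>\<^bsup>N\<^esup> \<Longrightarrow> x - y \<in> \<real>\<^bsup>N\<^esup>"
  by (rule subspace_diff[OF subspace_vec_space])

lemma vec_space_scale [simp]: "x \<in> \<real>\<^bsup>N\<^esup> \<Longrightarrow> c *\<^sub>R x \<in> \<real>\<^bsup>N\<^esup>"
  by (rule subspace_scale[OF subspace_vec_space])

lemma vec_space_empty: "\<real>\<^bsup>{}\<^esup> = {0}"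
  by (auto simp: vec_space_def fun_eq_iff)

lemma pullback_in_vec_space [simp]: "pullback N \<phi> y \<in> \<real>\<^bsup>N\<^esup>"
  by (simp add: pullback_def vec_space_def)

lemma linear_pullback: "linear (pullback N \<phi>)"
  by (rule linearI) (auto simp: pullback_def fun_eq_iff scaleR_fun_def)

lemmas pullback_add = linear_add[OF linear_pullback]
  and pullback_diff = linear_diff[OF linear_pullback]
  and pullback_scale = linear_scale[OF linear_pullback]

lemma pullback_id: "x \<in> \<real>\<^bsup>N\<^esup> \<Longrightarrow> (\<And>i. i \<in> N \<Longrightarrow> \<phi> i = i) \<Longrightarrow> pullback N \<phi> x = x"
  by (auto simp: pullback_def vec_space_def fun_eq_iff)

lemma pullback_pullback:
  "\<phi> \<in> N \<rightarrow> M \<Longrightarrow> pullback N \<phi> (pullback M \<psi> z) = pullback N (\<psi> \<circ> \<phi>) z"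
  by (auto simp: pullback_def fun_eq_iff)

lemma pullback_cong:
  "(\<And>i. i \<in> N \<Longrightarrow> \<phi> i = \<psi> i) \<Longrightarrow> pullback N \<phi> z = pullback N \<psi> z"
  by (auto simp: pullback_def fun_eq_iff)

lemma pushforward_in_vec_space [simp]:
  assumes "\<phi> \<in> N \<rightarrow> M"
  shows "pushforward N \<phi> x \<in> \<real>\<^bsup>M\<^esup>"
  using assms by (auto simp: vec_space_def pushforward_def intro!: sum.neutral)

lemma pushforward_add: "pushforward N \<phi> (x + y) = pushforward N \<phi> x + pushforward N \<phi> y"
  by (simp add: pushforward_def fun_eq_iff sum.distrib)

lemma pushforward_empty [simp]: "pushforward {} \<phi> x = 0"
  by (simp add: pushforward_def fun_eq_iff)

lemma pushforward_cong:
  "(\<And>i. i \<in> N \<Longrightarrow> \<phi> i = \<psi> i) \<Longrightarrow> pushforward N \<phi> = pushforward N \<psi>"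
  unfolding pushforward_def by (intro ext sum.cong) auto

lemma pushforward_apply_image:
  assumes "inj_on \<phi> N" "i \<in> N"
  shows "pushforward N \<phi> x (\<phi> i) = x i"
proof -
  have "{i' \<in> N. \<phi> i' = \<phi> i} = {i}"
    using assms by (auto dest: inj_onD)
  then show ?thesis by (simp add: pushforward_def)
qed

lemma pushforward_apply_outside: "j \<notin> \<phi> ` N \<Longrightarrow> pushforward N \<phi> x j = 0"
  unfolding pushforward_def by (rule sum.neutral) auto

lemma pushforward_id:
  assumes "x \<in> \<real>\<^bsup>N\<^esup>" "\<And>i. i \<in> N \<Longrightarrow> \<phi> i = i"
  shows "pushforward N \<phi> x = x"
proof
  fix i
  show "pushforward N \<phi> x i = x i"
  proof (cases "i \<in> N")
    case True
    then show ?thesis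
      using pushforward_apply_image[of \<phi> N i x] assms(2) by (simp add: inj_on_def)
  next
    case False
    then show ?thesis
      using assms pushforward_apply_outside[of i \<phi> N x] by (auto simp: vec_space_def)
  qed
qed

lemma pushforward_pushforward:
  assumes "finite N" "finite M" "\<phi> \<in> N \<rightarrow> M"
  shows "pushforward M \<psi> (pushforward N \<phi> x) = pushforward N (\<psi> \<circ> \<phi>) x"
proof
  fix k
  have "(\<Sum>i\<in>{i \<in> N. \<psi> (\<phi> i) = k}. x i)
      = (\<Sum>j\<in>{j \<in> M. \<psi> j = k}. \<Sum>i\<in>{i \<in> {i \<in> N. \<psi> (\<phi> i) = k}. \<phi> i = j}. x i)"
    using assms by (intro sum.group[symmetric]) auto
  also have "\<dots> = (\<Sum>j\<in>{j \<in> M. \<psi> j = k}. \<Sum>i\<in>{i \<in> N. \<phi> i = j}. x i)"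
    by (intro sum.cong) auto
  finally show "pushforward M \<psi> (pushforward N \<phi> x) k = pushforward N (\<psi> \<circ> \<phi>) x k"
    by (simp add: pushforward_def)
qed

lemma pushforward_image_pushforward_image:
  assumes "finite N" "finite M" "\<phi> \<in> N \<rightarrow> M"
  shows "pushforward M \<psi> ` pushforward N \<phi> ` A = pushforward N (\<psi> \<circ> \<phi>) ` A"
  by (simp add: image_image pushforward_pushforward[OF assms])

lemma pushforward_image_add:
  "pushforward N \<phi> ` (A + B) = pushforward N \<phi> ` A + pushforward N \<phi> ` B"
  by (force simp: set_plus_image image_def pushforward_add)

lemma pushforward_image_id:
  "A \<subseteq> \<real>\<^bsup>N\<^esup> \<Longrightarrow> (\<And>i. i \<in> N \<Longrightarrow> \<phi> i = i) \<Longrightarrow> pushforward N \<phi> ` A = A"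
  by (force simp: pushforward_id subset_eq image_iff)

definition pairing :: "'i set \<Rightarrow> ('i \<Rightarrow> real) \<Rightarrow> ('i \<Rightarrow> real) \<Rightarrow> real"
  where "pairing N w x = (\<Sum>i\<in>N. w i * x i)"

text \<open>
  Both sides sum \<open>w i * y (\<phi> i)\<close> over \<open>N\<close>, the left one grouped by the fibres of \<open>\<phi>\<close>.
\<close>

lemma pushforward_adjoint_pullback:
  assumes "finite N" "finite M" "\<phi> \<in> N \<rightarrow> M"
  shows "pairing M (pushforward N \<phi> w) y = pairing N w (pullback N \<phi> y)"
proof -
  have "pairing M (pushforward N \<phi> w) y = (\<Sum>j\<in>M. \<Sum>i\<in>{i \<in> N. \<phi> i = j}. w i * y (\<phi> i))"
    by (simp add: pairing_def pushforward_def sum_distrib_right)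
  also have "\<dots> = (\<Sum>i\<in>N. w i * y (\<phi> i))"
    using assms by (intro sum.group) auto
  also have "\<dots> = pairing N w (pullback N \<phi> y)"
    by (simp add: pairing_def pullback_def)
  finally show ?thesis .
qed

lemma linear_pairing: "linear (pairing N w)"
  by (rule linearI)
    (simp_all add: pairing_def scaleR_fun_def algebra_simps sum.distrib sum_distrib_left)

definition unit_vec :: "'i \<Rightarrow> 'i \<Rightarrow> real"
  where "unit_vec i = (\<lambda>k. if k = i then 1 else 0)"

lemma unit_vec_in_vec_space [simp]: "i \<in> N \<Longrightarrow> unit_vec i \<in> \<real>\<^bsup>N\<^esup>"
  by (auto simp: unit_vec_def vec_space_def)

lemma pairing_unit_vec: "finite N \<Longrightarrow> i \<in> N \<Longrightarrow> pairing N w (unit_vec i) = w i"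
  by (simp add: pairing_def unit_vec_def if_distrib[of "\<lambda>x. _ * x"] sum.delta' cong: if_cong)

lemma vec_space_eq_sum_unit_vec:
  assumes "finite N" "x \<in> \<real>\<^bsup>N\<^esup>"
  shows "x = (\<Sum>i\<in>N. x i *\<^sub>R unit_vec i)"
proof
  fix k
  have "(\<Sum>i\<in>A. x i *\<^sub>R unit_vec i) k = (\<Sum>i\<in>A. x i * unit_vec i k)" if "finite A" for A
    using that by (induction A rule: finite_induct) (simp_all add: scaleR_fun_def)
  then show "x k = (\<Sum>i\<in>N. x i *\<^sub>R unit_vec i) k"
    using assms by (simp add: unit_vec_def vec_space_def if_distrib[of "\<lambda>x. _ * x"] cong: if_cong)
qed

lemma span_unit_vec:
  assumes N: "finite N"
  shows "span (unit_vec ` N) = \<real>\<^bsup>N\<^esup>"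
proof
  show "span (unit_vec ` N) \<subseteq> \<real>\<^bsup>N\<^esup>"
    by (rule span_minimal) (auto simp: subspace_vec_space)
  show "\<real>\<^bsup>N\<^esup> \<subseteq> span (unit_vec ` N)"
  proof
    fix x assume x: "x \<in> \<real>\<^bsup>N\<^esup>"
    have "(\<Sum>i\<in>N. x i *\<^sub>R unit_vec i) \<in> span (unit_vec ` N)"
      by (intro span_sum span_scale span_base imageI)
    then show "x \<in> span (unit_vec ` N)"
      using vec_space_eq_sum_unit_vec[OF N x] by metis
  qed
qed

lemma linear_on_vec_space_eq_pairing:
  assumes N: "finite N" and l: "linear l"
  obtains v where "v \<in> \<real>\<^bsup>N\<^esup>" "\<And>x. x \<in> \<real>\<^bsup>N\<^esup> \<Longrightarrow> l x = pairing N v x"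
proof -
  define v where "v = (\<lambda>i. if i \<in> N then l (unit_vec i) else 0)"
  have "l x = pairing N v x" if "x \<in> \<real>\<^bsup>N\<^esup>" for x
  proof -
    have "l x = l (\<Sum>i\<in>N. x i *\<^sub>R unit_vec i)"
      using vec_space_eq_sum_unit_vec[OF N that] by simp
    also have "\<dots> = pairing N v x"
      by (simp add: linear_sum[OF l] linear_scale[OF l] pairing_def v_def mult.commute)
    finally show ?thesis .
  qed
  moreover have "v \<in> \<real>\<^bsup>N\<^esup>"
    by (simp add: v_def vec_space_def)
  ultimately show thesis by (rule that[rotated])
qed


section \<open>The chain rule along a map of finite sets\<close>

lemma superdifferential_iff:
  "w \<in> superdifferential N f x \<longleftrightarrow>
    w \<in> \<real>\<^bsup>N\<^esup> \<and> (\<forall>y\<in>\<real>\<^bsup>N\<^esup>. f y - f x \<le> pairing N w (y - x))"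
  by (simp add: superdifferential_def pairing_def)

lemma superdifferential_cong:
  "(\<And>y. y \<in> \<real>\<^bsup>N\<^esup> \<Longrightarrow> f y = g y) \<Longrightarrow> x \<in> \<real>\<^bsup>N\<^esup> \<Longrightarrow> superdifferential N f x = superdifferential N g x"
  by (simp add: superdifferential_def)

text \<open>
  If \<open>j\<close> is not in the image of \<open>\<phi>\<close>, then \<open>f \<circ> \<phi>\<^sup>*\<close> does not depend on the \<open>j\<close>-th coordinate, and the
  supergradient inequality in this direction reads \<open>0 \<le> t * w j\<close> for every real \<open>t\<close>.
\<close>

lemma supergradient_of_pullback_vanishes_off_image:
  assumes M: "finite M" and y: "y \<in> \<real>\<^bsup>M\<^esup>"
    and w: "w \<in> superdifferential M (\<lambda>y. f (pullback N \<phi> y)) y" and j: "j \<notin> \<phi> ` N"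
  shows "w j = 0"
proof (cases "j \<in> M")
  case True
  have z: "pullback N \<phi> (unit_vec j) = 0"
    using j by (auto simp: pullback_def unit_vec_def fun_eq_iff)
  have "f (pullback N \<phi> (y + t *\<^sub>R unit_vec j)) - f (pullback N \<phi> y)
      \<le> pairing M w ((y + t *\<^sub>R unit_vec j) - y)" for t
  proof -
    have "y + t *\<^sub>R unit_vec j \<in> \<real>\<^bsup>M\<^esup>"
      using y True by simp
    then show ?thesis
      using w unfolding superdifferential_iff by blast
  qed
  then have "0 \<le> t * w j" for t
    by (simp add: z pullback_add pullback_scale linear_scale[OF linear_pairing]
        pairing_unit_vec[OF M True])
  from this[of 1] this[of "- 1"] show ?thesis by simp
next
  case False
  then show ?thesis using w by (auto simp: superdifferential_iff vec_space_def)
qed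

text \<open>
  A preimage of a supergradient \<open>w\<close> under \<open>\<phi>\<^sub>*\<close> is a supergradient \<open>v\<close> of \<open>f\<close> with
  \<open>v\<^sup>T (\<phi>\<^sup>* z) = w\<^sup>T z\<close> for all \<open>z\<close>. This prescribes \<open>v\<close> as a functional on the range \<open>S\<close> of \<open>\<phi>\<^sup>*\<close>. There it
  dominates the increments \<open>g\<close> of \<open>f\<close> at \<open>\<phi>\<^sup>* y\<close>, so it has a dominating extension to \<open>\<real>\<^bsup>N\<^esup>\<close>.
\<close>

lemma superdifferential_pullback:
  fixes f :: "('i \<Rightarrow> real) \<Rightarrow> real" and \<phi> :: "'i \<Rightarrow> 'j"
  assumes N: "finite N" and M: "finite M" and \<phi>: "\<phi> \<in> N \<rightarrow> M"
    and f: "concave_on \<real>\<^bsup>N\<^esup> f" and y: "y \<in> \<real>\<^bsup>M\<^esup>"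
  shows "superdifferential M (\<lambda>y. f (pullback N \<phi> y)) y =
    pushforward N \<phi> ` superdifferential N f (pullback N \<phi> y)"
proof (intro subset_antisym subsetI)
  fix w assume "w \<in> pushforward N \<phi> ` superdifferential N f (pullback N \<phi> y)"
  then show "w \<in> superdifferential M (\<lambda>y. f (pullback N \<phi> y)) y"
    using \<phi> by (auto simp: superdifferential_iff pushforward_adjoint_pullback[OF N M \<phi>] pullback_diff)
next
  fix w assume w: "w \<in> superdifferential M (\<lambda>y. f (pullback N \<phi> y)) y"
  let ?a = "pullback N \<phi> y"
  define g where "g x = f (?a + x) - f ?a" for x
  define S where "S = pullback N \<phi> ` \<real>\<^bsup>M\<^esup>"
  (* With a section of \<phi> onto its image, the functional \<phi>\<^sup>* z \<mapsto> w\<^sup>T z becomes a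
     formula that is linear in every argument, not only in those from S. *)
  define l where "l x = (\<Sum>j\<in>\<phi> ` N. w j * x (inv_into N \<phi> j))" for x
  have "subspace S"
    unfolding S_def using linear_pullback subspace_vec_space by (rule linear_subspace_image)
  have sp: "span (unit_vec ` N \<union> S) = \<real>\<^bsup>N\<^esup>"
  proof
    show "span (unit_vec ` N \<union> S) \<subseteq> \<real>\<^bsup>N\<^esup>"
      by (rule span_minimal) (auto simp: S_def subspace_vec_space)
    show "\<real>\<^bsup>N\<^esup> \<subseteq> span (unit_vec ` N \<union> S)"
      using span_mono[of "unit_vec ` N" "unit_vec ` N \<union> S"] by (simp add: span_unit_vec[OF N])
  qed
  have "concave_on \<real>\<^bsup>N\<^esup> g"
    unfolding concave_on_iff
  proof (intro conjI ballI allI impI)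
    show "convex \<real>\<^bsup>N\<^esup>" by (rule subspace_imp_convex[OF subspace_vec_space])
    fix x x' and u v :: real
    assume h: "x \<in> \<real>\<^bsup>N\<^esup>" "x' \<in> \<real>\<^bsup>N\<^esup>" "0 \<le> u" "0 \<le> v" "u + v = 1"
    have "?a = u *\<^sub>R ?a + v *\<^sub>R ?a"
      using h(5) by (simp flip: scaleR_add_left)
    then have "?a + (u *\<^sub>R x + v *\<^sub>R x') = u *\<^sub>R (?a + x) + v *\<^sub>R (?a + x')"
      by (simp add: scaleR_add_right algebra_simps)
    moreover have "u * f (?a + x) + v * f (?a + x') \<le> f (u *\<^sub>R (?a + x) + v *\<^sub>R (?a + x'))"
      using f h by (simp add: concave_on_iff)
    moreover have "f ?a = u * f ?a + v * f ?a"
      using h(5) by (simp flip: distrib_right)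
    ultimately show "u * g x + v * g x' \<le> g (u *\<^sub>R x + v *\<^sub>R x')"
      by (simp add: g_def algebra_simps)
  qed
  then have "concave_on (span (unit_vec ` N \<union> S)) g"
    by (simp add: sp)
  moreover have "linear l"
    by (rule linearI) (simp_all add: l_def scaleR_fun_def algebra_simps sum.distrib sum_distrib_left)
  moreover have l_pullback: "l (pullback N \<phi> z) = pairing M w z" for z
  proof -
    have "l (pullback N \<phi> z) = (\<Sum>j\<in>\<phi> ` N. w j * z j)"
      unfolding l_def
      by (intro sum.cong refl) (simp add: pullback_def inv_into_into f_inv_into_f)
    also have "\<dots> = pairing M w z"
      unfolding pairing_def
      using M \<phi> supergradient_of_pullback_vanishes_off_image[OF M y w]
      by (intro sum.mono_neutral_left) auto
    finally show ?thesis .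
  qed
  moreover have "g x \<le> l x" if x: "x \<in> S" for x
  proof -
    obtain z where z: "z \<in> \<real>\<^bsup>M\<^esup>" "x = pullback N \<phi> z"
      using x unfolding S_def by blast
    have "f (pullback N \<phi> (y + z)) - f (pullback N \<phi> y) \<le> pairing M w ((y + z) - y)"
      using w vec_space_add[OF y z(1)] unfolding superdifferential_iff by blast
    then show ?thesis
      by (simp add: g_def z(2) l_pullback pullback_add)
  qed
  ultimately obtain l' where l': "linear l'" "\<And>x. x \<in> S \<Longrightarrow> l' x = l x"
    "\<And>x. x \<in> \<real>\<^bsup>N\<^esup> \<Longrightarrow> g x \<le> l' x"
    using concave_dominated_extension[of "unit_vec ` N" S g l] N \<open>subspace S\<close> sp by blast
  obtain v where v: "v \<in> \<real>\<^bsup>N\<^esup>" "\<And>x. x \<in> \<real>\<^bsup>N\<^esup> \<Longrightarrow> l' x = pairing N v x"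
    using linear_on_vec_space_eq_pairing[OF N l'(1)] by blast
  have "f x - f ?a \<le> pairing N v (x - ?a)" if "x \<in> \<real>\<^bsup>N\<^esup>" for x
    using l'(3)[of "x - ?a"] v(2)[of "x - ?a"] that by (simp add: g_def)
  then have "v \<in> superdifferential N f ?a"
    using v(1) by (simp add: superdifferential_iff)
  moreover have "pushforward N \<phi> v = w"
  proof
    fix j
    show "pushforward N \<phi> v j = w j"
    proof (cases "j \<in> M")
      case True
      then have "pushforward N \<phi> v j = pairing N v (pullback N \<phi> (unit_vec j))"
        using pairing_unit_vec[OF M True] pushforward_adjoint_pullback[OF N M \<phi>] by metis
      also have "\<dots> = l (pullback N \<phi> (unit_vec j))"
        using l'(2)[of "pullback N \<phi> (unit_vec j)"] v(2)[of "pullback N \<phi> (unit_vec j)"] True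
        by (simp add: S_def)
      also have "\<dots> = w j"
        by (simp add: l_pullback pairing_unit_vec[OF M True])
      finally show ?thesis .
    next
      case False
      then show ?thesis
        using w pushforward_in_vec_space[OF \<phi>, of v] by (auto simp: superdifferential_iff vec_space_def)
    qed
  qed
  ultimately show "w \<in> pushforward N \<phi> ` superdifferential N f ?a" by blast
qed


section \<open>Disjoint unions\<close>

lemma coprod_mem_iff [simp]:
  "Lft n \<in> N \<^bold>+ M \<longleftrightarrow> n \<in> N" "Rgt m \<in> N \<^bold>+ M \<longleftrightarrow> m \<in> M" "Atom a \<notin> N \<^bold>+ M"
  by (auto simp: coprod_def)

lemma coprod_cases:
  assumes "i \<in> N \<^bold>+ M"
  obtains n where "i = Lft n" "n \<in> N" | m where "i = Rgt m" "m \<in> M"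
  using assms by (auto simp: coprod_def)

lemma finite_coprod [simp]: "finite N \<Longrightarrow> finite M \<Longrightarrow> finite (N \<^bold>+ M)"
  by (simp add: coprod_def)

lemma incl_apply [simp]:
  "n \<in> N \<Longrightarrow> incl_left N n = Lft n" "m \<in> M \<Longrightarrow> incl_right M m = Rgt m"
  by (simp_all add: incl_left_def incl_right_def)

lemma incl_Pi [simp]: "incl_left N \<in> N \<rightarrow> N \<^bold>+ M" "incl_right M \<in> M \<rightarrow> N \<^bold>+ M"
  by auto

lemma inj_on_incl: "inj_on (incl_left N) N" "inj_on (incl_right M) M"
  by (auto simp: inj_on_def)

lemma coprod_map_apply [simp]:
  "n \<in> N \<Longrightarrow> coprod_map N M \<phi> \<psi> (Lft n) = Lft (\<phi> n)"
  "m \<in> M \<Longrightarrow> coprod_map N M \<phi> \<psi> (Rgt m) = Rgt (\<psi> m)"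
  by (simp_all add: coprod_map_def)

lemma associator_apply [simp]:
  "n \<in> N \<Longrightarrow> associator N M K (Lft (Lft n)) = Lft n"
  "m \<in> M \<Longrightarrow> associator N M K (Lft (Rgt m)) = Rgt (Lft m)"
  "k \<in> K \<Longrightarrow> associator N M K (Rgt k) = Rgt (Rgt k)"
  by (simp_all add: associator_def)

lemma unitor_apply [simp]:
  "n \<in> N \<Longrightarrow> left_unitor N (Rgt n) = n" "n \<in> N \<Longrightarrow> right_unitor N (Lft n) = n"
  by (simp_all add: left_unitor_def right_unitor_def)

lemma braiding_apply [simp]:
  "n \<in> N \<Longrightarrow> braiding N M (Lft n) = Rgt n" "m \<in> M \<Longrightarrow> braiding N M (Rgt m) = Lft m"
  by (simp_all add: braiding_def)

lemma pairing_coprod: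
  assumes "finite N" "finite M"
  shows "pairing (N \<^bold>+ M) w x =
    pairing N (pullback N (incl_left N) w) (pullback N (incl_left N) x) +
    pairing M (pullback M (incl_right M) w) (pullback M (incl_right M) x)"
proof -
  have "pairing (N \<^bold>+ M) w x = (\<Sum>i\<in>Lft ` N. w i * x i) + (\<Sum>i\<in>Rgt ` M. w i * x i)"
    unfolding pairing_def coprod_def using assms by (intro sum.union_disjoint) auto
  also have "\<dots> = (\<Sum>n\<in>N. w (Lft n) * x (Lft n)) + (\<Sum>m\<in>M. w (Rgt m) * x (Rgt m))"
    by (simp add: sum.reindex inj_on_def)
  finally show ?thesis
    by (simp add: pairing_def pullback_def)
qed

lemma pushforward_incl_apply:
  "n \<in> N \<Longrightarrow> pushforward N (incl_left N) u (Lft n) = u n"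
  "m \<in> M \<Longrightarrow> pushforward M (incl_right M) v (Rgt m) = v m"
  "pushforward N (incl_left N) u (Rgt m) = 0"
  "pushforward M (incl_right M) v (Lft n) = 0"
  using pushforward_apply_image[OF inj_on_incl(1), of n N u]
    pushforward_apply_image[OF inj_on_incl(2), of m M v]
  by (auto intro!: pushforward_apply_outside)

lemma pullback_incl_pushforward_incl:
  assumes "u \<in> \<real>\<^bsup>N\<^esup>" "v \<in> \<real>\<^bsup>M\<^esup>"
  shows "pullback N (incl_left N) (pushforward N (incl_left N) u + pushforward M (incl_right M) v) = u"
    and "pullback M (incl_right M) (pushforward N (incl_left N) u + pushforward M (incl_right M) v) = v"
  using assms by (auto simp: pullback_def fun_eq_iff vec_space_def pushforward_incl_apply)

lemma pushforward_incl_pullback_incl: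
  assumes "w \<in> \<real>\<^bsup>N \<^bold>+ M\<^esup>"
  shows "pushforward N (incl_left N) (pullback N (incl_left N) w) +
    pushforward M (incl_right M) (pullback M (incl_right M) w) = w"
    (is "?l + ?r = w")
proof
  fix i
  have "?l + ?r \<in> \<real>\<^bsup>N \<^bold>+ M\<^esup>" by simp
  with assms show "(?l + ?r) i = w i"
    by (cases "i \<in> N \<^bold>+ M")
      (auto simp: vec_space_def pushforward_incl_apply pullback_def elim!: coprod_cases)
qed

text \<open>
  By \<open>pairing_coprod\<close>, a linear functional on \<open>\<real>\<^bsup>N \<^bold>+ M\<^esup>\<close> is the sum of its two blocks. To see that each
  block of a supergradient is a supergradient of its summand, the variables of the other summand are kept at the
  base point, so that the other terms of the inequality vanish.
\<close>

lemma superdifferential_coprod: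
  assumes N: "finite N" and M: "finite M" and z: "z \<in> \<real>\<^bsup>N \<^bold>+ M\<^esup>"
  shows "superdifferential (N \<^bold>+ M)
      (\<lambda>z. f (pullback N (incl_left N) z) + g (pullback M (incl_right M) z)) z =
    pushforward N (incl_left N) ` superdifferential N f (pullback N (incl_left N) z) +
    pushforward M (incl_right M) ` superdifferential M g (pullback M (incl_right M) z)"
    (is "?D = ?l ` ?F + ?r ` ?G")
proof (intro subset_antisym subsetI)
  fix w assume "w \<in> ?l ` ?F + ?r ` ?G"
  then obtain u v where w: "w = ?l u + ?r v" and uv: "u \<in> ?F" "v \<in> ?G"
    by (auto elim!: set_plus_elim)
  have "u \<in> \<real>\<^bsup>N\<^esup>" "v \<in> \<real>\<^bsup>M\<^esup>"
    using uv by (auto simp: superdifferential_iff)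
  then have "pairing (N \<^bold>+ M) w x =
      pairing N u (pullback N (incl_left N) x) + pairing M v (pullback M (incl_right M) x)" for x
    by (simp add: pairing_coprod[OF N M] w pullback_incl_pushforward_incl)
  moreover have "w \<in> \<real>\<^bsup>N \<^bold>+ M\<^esup>"
    by (simp add: w)
  moreover have "f (pullback N (incl_left N) y) + g (pullback M (incl_right M) y) -
      (f (pullback N (incl_left N) z) + g (pullback M (incl_right M) z))
      \<le> pairing N u (pullback N (incl_left N) y - pullback N (incl_left N) z) +
        pairing M v (pullback M (incl_right M) y - pullback M (incl_right M) z)" for y
  proof -
    have "f (pullback N (incl_left N) y) - f (pullback N (incl_left N) z)
        \<le> pairing N u (pullback N (incl_left N) y - pullback N (incl_left N) z)"
      using uv(1) by (simp add: superdifferential_iff)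
    moreover have "g (pullback M (incl_right M) y) - g (pullback M (incl_right M) z)
        \<le> pairing M v (pullback M (incl_right M) y - pullback M (incl_right M) z)"
      using uv(2) by (simp add: superdifferential_iff)
    ultimately show ?thesis by linarith
  qed
  ultimately show "w \<in> ?D"
    by (simp add: superdifferential_iff pullback_diff)
next
  fix w assume w: "w \<in> ?D"
  then have wN: "w \<in> \<real>\<^bsup>N \<^bold>+ M\<^esup>"
    by (simp add: superdifferential_iff)
  have le: "f (pullback N (incl_left N) y) + g (pullback M (incl_right M) y) -
      (f (pullback N (incl_left N) z) + g (pullback M (incl_right M) z))
      \<le> pairing N (pullback N (incl_left N) w) (pullback N (incl_left N) y - pullback N (incl_left N) z) +
        pairing M (pullback M (incl_right M) w) (pullback M (incl_right M) y - pullback M (incl_right M) z)"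
    if "y \<in> \<real>\<^bsup>N \<^bold>+ M\<^esup>" for y
    using w that by (auto simp: superdifferential_iff pairing_coprod[OF N M] pullback_diff)
  have le': "f a + g b - (f (pullback N (incl_left N) z) + g (pullback M (incl_right M) z))
      \<le> pairing N (pullback N (incl_left N) w) (a - pullback N (incl_left N) z) +
        pairing M (pullback M (incl_right M) w) (b - pullback M (incl_right M) z)"
    if "a \<in> \<real>\<^bsup>N\<^esup>" "b \<in> \<real>\<^bsup>M\<^esup>" for a b
    using le[of "?l a + ?r b"] that by (simp add: pullback_incl_pushforward_incl)
  have "pullback N (incl_left N) w \<in> ?F"
    using le'[of _ "pullback M (incl_right M) z"]
    by (simp add: superdifferential_iff linear_0[OF linear_pairing])
  moreover have "pullback M (incl_right M) w \<in> ?G"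
    using le'[of "pullback N (incl_left N) z"]
    by (simp add: superdifferential_iff linear_0[OF linear_pairing])
  ultimately show "w \<in> ?l ` ?F + ?r ` ?G"
    using pushforward_incl_pullback_incl[OF wN] by (metis imageI set_plus_intro)
qed


section \<open>Coherence\<close>

lemma Conc_sel:
  "Obj Conc N = {f \<in> \<real>\<^bsup>N\<^esup> \<rightarrow>\<^sub>E UNIV. concave_on (\<real>\<^bsup>N\<^esup>) f}"
  "Map Conc N M \<phi> f = (\<lambda>y\<in>\<real>\<^bsup>M\<^esup>. f (pullback N \<phi> y))"
  "Prod_comp Conc N M (f, g) = (\<lambda>z\<in>\<real>\<^bsup>N \<^bold>+ M\<^esup>.
      f (pullback N (incl_left N) z) + g (pullback M (incl_right M) z))"
  "Unit_comp Conc u = (\<lambda>z\<in>\<real>\<^bsup>{}\<^esup>. 0)"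
  by (simp_all add: Conc_def)

lemma NDD_sel:
  "Obj NDD N = \<real>\<^bsup>N\<^esup> \<rightarrow>\<^sub>E Pow (\<real>\<^bsup>N\<^esup>)"
  "Map NDD N M \<phi> \<upsilon> = (\<lambda>y\<in>\<real>\<^bsup>M\<^esup>. pushforward N \<phi> ` \<upsilon> (pullback N \<phi> y))"
  "Prod_comp NDD N M (\<upsilon>, \<rho>) = (\<lambda>z\<in>\<real>\<^bsup>N \<^bold>+ M\<^esup>.
      pushforward N (incl_left N) ` \<upsilon> (pullback N (incl_left N) z) +
      pushforward M (incl_right M) ` \<rho> (pullback M (incl_right M) z))"
  "Unit_comp NDD u = (\<lambda>z\<in>\<real>\<^bsup>{}\<^esup>. {0})"
  by (simp_all add: NDD_def)

lemma concave_on_compose_pullback: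
  assumes "concave_on \<real>\<^bsup>N\<^esup> f"
  shows "concave_on \<real>\<^bsup>M\<^esup> (\<lambda>y. f (pullback N \<phi> y))"
  using assms subspace_imp_convex[OF subspace_vec_space]
  by (simp add: concave_on_iff pullback_add pullback_scale)

lemma concave_on_restrict:
  "concave_on S (restrict f S) \<longleftrightarrow> concave_on S f"
  unfolding concave_on_iff by (rule conj_cong[OF refl]) (simp add: convexD cong: ball_cong)

lemma PiE_restrict_eqI:
  "x \<in> A \<rightarrow>\<^sub>E B \<Longrightarrow> (\<And>y. y \<in> A \<Longrightarrow> f y = x y) \<Longrightarrow> restrict f A = x"
  by (auto simp: fun_eq_iff PiE_def extensional_def restrict_def)

lemma is_functor_Conc: "is_functor Conc"
  unfolding is_functor_def
proof (intro conjI allI impI ballI)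
  fix N M :: "'a elt set" and \<phi> assume "finite N" "finite M" "\<phi> \<in> N \<rightarrow>\<^sub>E M"
  show "Map Conc N M \<phi> \<in> Obj Conc N \<rightarrow> Obj Conc M"
    by (auto simp: Conc_sel concave_on_restrict concave_on_compose_pullback)
next
  fix N :: "'a elt set" and f assume "finite N" "f \<in> Obj Conc N"
  then show "Map Conc N N (restrict id N) f = f"
    unfolding Conc_sel by (intro PiE_restrict_eqI) (auto simp: pullback_id)
next
  fix N M K :: "'a elt set" and \<phi> \<psi> f
  assume "\<phi> \<in> N \<rightarrow>\<^sub>E M" "\<psi> \<in> M \<rightarrow>\<^sub>E K"
  then have "pullback N (compose N \<psi> \<phi>) y = pullback N \<phi> (pullback M \<psi> y)" for y
    by (subst pullback_pullback) (auto intro!: pullback_cong simp: compose_def)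
  then show "Map Conc N K (compose N \<psi> \<phi>) f = Map Conc M K \<psi> (Map Conc N M \<phi> f)"
    by (simp add: Conc_sel cong: restrict_cong)
qed

lemma is_functor_NDD: "is_functor NDD"
  unfolding is_functor_def
proof (intro conjI allI impI ballI)
  fix N M :: "'a elt set" and \<phi> assume "finite N" "finite M" "\<phi> \<in> N \<rightarrow>\<^sub>E M"
  then have "\<phi> \<in> N \<rightarrow> M" by auto
  then show "Map NDD N M \<phi> \<in> Obj NDD N \<rightarrow> Obj NDD M"
    by (auto simp: NDD_sel)
next
  fix N :: "'a elt set" and \<upsilon> assume "\<upsilon> \<in> Obj NDD N"
  then have \<upsilon>: "\<upsilon> \<in> \<real>\<^bsup>N\<^esup> \<rightarrow>\<^sub>E Pow (\<real>\<^bsup>N\<^esup>)" and "\<And>z. z \<in> \<real>\<^bsup>N\<^esup> \<Longrightarrow> \<upsilon> z \<subseteq> \<real>\<^bsup>N\<^esup>"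
    by (auto simp: NDD_sel)
  then show "Map NDD N N (restrict id N) \<upsilon> = \<upsilon>"
    unfolding NDD_sel by (intro PiE_restrict_eqI[OF \<upsilon>]) (simp add: pullback_id pushforward_image_id)
next
  fix N M K :: "'a elt set" and \<phi> \<psi> \<upsilon>
  assume fin: "finite N" "finite M" and \<phi>: "\<phi> \<in> N \<rightarrow>\<^sub>E M" and "\<psi> \<in> M \<rightarrow>\<^sub>E K"
  then have "pullback N (compose N \<psi> \<phi>) y = pullback N \<phi> (pullback M \<psi> y)" for y
    by (subst pullback_pullback) (auto intro!: pullback_cong simp: compose_def)
  moreover have "pushforward M \<psi> ` pushforward N \<phi> ` A = pushforward N (compose N \<psi> \<phi>) ` A" for A
    using fin \<phi> pushforward_cong[of N "compose N \<psi> \<phi>" "\<psi> \<circ> \<phi>"]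
    by (subst pushforward_image_pushforward_image) (auto simp: compose_def)
  ultimately show "Map NDD N K (compose N \<psi> \<phi>) \<upsilon> = Map NDD M K \<psi> (Map NDD N M \<phi> \<upsilon>)"
    by (simp add: NDD_sel cong: restrict_cong)
qed

text \<open>
  The coherence conditions come down to the values of the structural maps on the summands of a
  disjoint union. For each map, the following lemmas and their counterparts for pushforward turn
  these values into equations that rewrite both sides of a condition to the same expression.
\<close>

lemma pullback_coprod_map:
  assumes "\<phi> \<in> N \<rightarrow> N'" "\<psi> \<in> M \<rightarrow> M'"
  shows "pullback N (incl_left N) (pullback (N \<^bold>+ M) (coprod_map N M \<phi> \<psi>) z) =
      pullback N \<phi> (pullback N' (incl_left N') z)"
    and "pullback M (incl_right M) (pullback (N \<^bold>+ M) (coprod_map N M \<phi> \<psi>) z) =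
      pullback M \<psi> (pullback M' (incl_right M') z)"
  using assms by (auto simp: pullback_def fun_eq_iff)

lemma pullback_associator:
  "pullback N (incl_left N) (pullback (N \<^bold>+ M) (incl_left (N \<^bold>+ M))
      (pullback ((N \<^bold>+ M) \<^bold>+ K) (associator N M K) z)) = pullback N (incl_left N) z"
  "pullback M (incl_right M) (pullback (N \<^bold>+ M) (incl_left (N \<^bold>+ M))
      (pullback ((N \<^bold>+ M) \<^bold>+ K) (associator N M K) z)) =
    pullback M (incl_left M) (pullback (M \<^bold>+ K) (incl_right (M \<^bold>+ K)) z)"
  "pullback K (incl_right K) (pullback ((N \<^bold>+ M) \<^bold>+ K) (associator N M K) z) =
    pullback K (incl_right K) (pullback (M \<^bold>+ K) (incl_right (M \<^bold>+ K)) z)"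
  by (auto simp: pullback_def fun_eq_iff)

lemma pullback_unitor:
  assumes "z \<in> \<real>\<^bsup>N\<^esup>"
  shows "pullback N (incl_right N) (pullback ({} \<^bold>+ N) (left_unitor N) z) = z"
    and "pullback N (incl_left N) (pullback (N \<^bold>+ {}) (right_unitor N) z) = z"
  using assms by (auto simp: pullback_def fun_eq_iff vec_space_def)

lemma pullback_braiding:
  "pullback N (incl_left N) (pullback (N \<^bold>+ M) (braiding N M) z) = pullback N (incl_right N) z"
  "pullback M (incl_right M) (pullback (N \<^bold>+ M) (braiding N M) z) = pullback M (incl_left M) z"
  by (auto simp: pullback_def fun_eq_iff)

lemma lax_symmetric_monoidal_functor_Conc: "lax_symmetric_monoidal_functor Conc"
  unfolding lax_symmetric_monoidal_functor_def
proof (intro conjI allI impI ballI)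
  show "is_functor Conc" by (rule is_functor_Conc)
next
  fix N M :: "'a elt set"
  show "Prod_comp Conc N M \<in> Obj Conc N \<times> Obj Conc M \<rightarrow> Obj Conc (N \<^bold>+ M)"
    by (auto simp: Conc_sel concave_on_restrict intro!: concave_on_add concave_on_compose_pullback)
next
  show "Unit_comp Conc \<in> UNIV \<rightarrow> Obj Conc {}"
    by (auto simp: Conc_sel concave_on_restrict concave_on_const
        subspace_imp_convex[OF subspace_vec_space])
next
  fix N N' M M' :: "'a elt set" and \<phi> \<psi> f g
  assume "\<phi> \<in> N \<rightarrow>\<^sub>E N'" "\<psi> \<in> M \<rightarrow>\<^sub>E M'"
  then have "\<phi> \<in> N \<rightarrow> N'" "\<psi> \<in> M \<rightarrow> M'" by auto
  then show "Map Conc (N \<^bold>+ M) (N' \<^bold>+ M') (coprod_map N M \<phi> \<psi>) (Prod_comp Conc N M (f, g)) =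
      Prod_comp Conc N' M' (Map Conc N N' \<phi> f, Map Conc M M' \<psi> g)"
    by (simp add: Conc_sel pullback_coprod_map cong: restrict_cong)
next
  fix N M K :: "'a elt set" and f g h
  show "Map Conc ((N \<^bold>+ M) \<^bold>+ K) (N \<^bold>+ (M \<^bold>+ K)) (associator N M K)
        (Prod_comp Conc (N \<^bold>+ M) K (Prod_comp Conc N M (f, g), h)) =
      Prod_comp Conc N (M \<^bold>+ K) (f, Prod_comp Conc M K (g, h))"
    by (simp add: Conc_sel pullback_associator add.assoc cong: restrict_cong)
next
  fix N :: "'a elt set" and f assume f: "f \<in> Obj Conc N"
  then show "Map Conc ({} \<^bold>+ N) N (left_unitor N) (Prod_comp Conc {} N (Unit_comp Conc (), f)) = f"
    unfolding Conc_sel by (intro PiE_restrict_eqI) (auto simp: pullback_unitor)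
  show "Map Conc (N \<^bold>+ {}) N (right_unitor N) (Prod_comp Conc N {} (f, Unit_comp Conc ())) = f"
    using f unfolding Conc_sel by (intro PiE_restrict_eqI) (auto simp: pullback_unitor)
next
  fix N M :: "'a elt set" and f g
  show "Map Conc (N \<^bold>+ M) (M \<^bold>+ N) (braiding N M) (Prod_comp Conc N M (f, g)) =
      Prod_comp Conc M N (g, f)"
    by (simp add: Conc_sel pullback_braiding add.commute cong: restrict_cong)
qed

lemma pushforward_coprod_map:
  assumes "finite N" "finite N'" "finite M" "finite M'" "\<phi> \<in> N \<rightarrow> N'" "\<psi> \<in> M \<rightarrow> M'"
  shows "pushforward (N \<^bold>+ M) (coprod_map N M \<phi> \<psi>) ` pushforward N (incl_left N) ` A =
      pushforward N' (incl_left N') ` pushforward N \<phi> ` A"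
    and "pushforward (N \<^bold>+ M) (coprod_map N M \<phi> \<psi>) ` pushforward M (incl_right M) ` B =
      pushforward M' (incl_right M') ` pushforward M \<psi> ` B"
  using assms
    pushforward_cong[of N "coprod_map N M \<phi> \<psi> \<circ> incl_left N" "incl_left N' \<circ> \<phi>"]
    pushforward_cong[of M "coprod_map N M \<phi> \<psi> \<circ> incl_right M" "incl_right M' \<circ> \<psi>"]
  by (simp_all add: pushforward_image_pushforward_image Pi_iff)

lemma pushforward_associator:
  assumes "finite N" "finite M" "finite K"
  shows "pushforward ((N \<^bold>+ M) \<^bold>+ K) (associator N M K) ` pushforward (N \<^bold>+ M) (incl_left (N \<^bold>+ M)) `
      pushforward N (incl_left N) ` A = pushforward N (incl_left N) ` A"
    and "pushforward ((N \<^bold>+ M) \<^bold>+ K) (associator N M K) ` pushforward (N \<^bold>+ M) (incl_left (N \<^bold>+ M)) `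
      pushforward M (incl_right M) ` B =
      pushforward (M \<^bold>+ K) (incl_right (M \<^bold>+ K)) ` pushforward M (incl_left M) ` B"
    and "pushforward ((N \<^bold>+ M) \<^bold>+ K) (associator N M K) ` pushforward K (incl_right K) ` C =
      pushforward (M \<^bold>+ K) (incl_right (M \<^bold>+ K)) ` pushforward K (incl_right K) ` C"
  using assms
    pushforward_cong[of N "associator N M K \<circ> incl_left (N \<^bold>+ M) \<circ> incl_left N" "incl_left N"]
    pushforward_cong[of M "associator N M K \<circ> incl_left (N \<^bold>+ M) \<circ> incl_right M"
      "incl_right (M \<^bold>+ K) \<circ> incl_left M"]
    pushforward_cong[of K "associator N M K \<circ> incl_right K" "incl_right (M \<^bold>+ K) \<circ> incl_right K"]
  by (simp_all add: pushforward_image_pushforward_image Pi_iff comp_assoc)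

lemma pushforward_unitor:
  assumes "finite N" "A \<subseteq> \<real>\<^bsup>N\<^esup>"
  shows "pushforward ({} \<^bold>+ N) (left_unitor N) ` pushforward N (incl_right N) ` A = A"
    and "pushforward (N \<^bold>+ {}) (right_unitor N) ` pushforward N (incl_left N) ` A = A"
  using assms by (simp_all add: pushforward_image_pushforward_image Pi_iff pushforward_image_id)

lemma pushforward_braiding:
  assumes "finite N" "finite M"
  shows "pushforward (N \<^bold>+ M) (braiding N M) ` pushforward N (incl_left N) ` A =
      pushforward N (incl_right N) ` A"
    and "pushforward (N \<^bold>+ M) (braiding N M) ` pushforward M (incl_right M) ` B =
      pushforward M (incl_left M) ` B"
  using assms
    pushforward_cong[of N "braiding N M \<circ> incl_left N" "incl_right N"]
    pushforward_cong[of M "braiding N M \<circ> incl_right M" "incl_left M"]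
  by (simp_all add: pushforward_image_pushforward_image Pi_iff)

lemma lax_symmetric_monoidal_functor_NDD: "lax_symmetric_monoidal_functor NDD"
  unfolding lax_symmetric_monoidal_functor_def
proof (intro conjI allI impI ballI)
  show "is_functor NDD" by (rule is_functor_NDD)
next
  fix N M :: "'a elt set"
  show "Prod_comp NDD N M \<in> Obj NDD N \<times> Obj NDD M \<rightarrow> Obj NDD (N \<^bold>+ M)"
    by (auto simp: NDD_sel elim!: set_plus_elim)
next
  show "Unit_comp NDD \<in> UNIV \<rightarrow> Obj NDD {}"
    by (auto simp: NDD_sel)
next
  fix N N' M M' :: "'a elt set" and \<phi> \<psi> \<upsilon> \<rho>
  assume fin: "finite N" "finite N'" "finite M" "finite M'"
    and "\<phi> \<in> N \<rightarrow>\<^sub>E N'" "\<psi> \<in> M \<rightarrow>\<^sub>E M'"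
  then have "\<phi> \<in> N \<rightarrow> N'" "\<psi> \<in> M \<rightarrow> M'" by auto
  with fin show "Map NDD (N \<^bold>+ M) (N' \<^bold>+ M') (coprod_map N M \<phi> \<psi>) (Prod_comp NDD N M (\<upsilon>, \<rho>)) =
      Prod_comp NDD N' M' (Map NDD N N' \<phi> \<upsilon>, Map NDD M M' \<psi> \<rho>)"
    by (simp add: NDD_sel pullback_coprod_map pushforward_coprod_map pushforward_image_add
        cong: restrict_cong)
next
  fix N M K :: "'a elt set" and \<upsilon> \<rho> \<sigma>
  assume "finite N" "finite M" "finite K"
  then show "Map NDD ((N \<^bold>+ M) \<^bold>+ K) (N \<^bold>+ (M \<^bold>+ K)) (associator N M K)
        (Prod_comp NDD (N \<^bold>+ M) K (Prod_comp NDD N M (\<upsilon>, \<rho>), \<sigma>)) =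
      Prod_comp NDD N (M \<^bold>+ K) (\<upsilon>, Prod_comp NDD M K (\<rho>, \<sigma>))"
    by (simp add: NDD_sel pullback_associator pushforward_associator pushforward_image_add add.assoc
        cong: restrict_cong)
next
  fix N :: "'a elt set" and \<upsilon> assume N: "finite N" and "\<upsilon> \<in> Obj NDD N"
  then have \<upsilon>: "\<upsilon> \<in> \<real>\<^bsup>N\<^esup> \<rightarrow>\<^sub>E Pow (\<real>\<^bsup>N\<^esup>)" and sub: "\<And>z. z \<in> \<real>\<^bsup>N\<^esup> \<Longrightarrow> \<upsilon> z \<subseteq> \<real>\<^bsup>N\<^esup>"
    by (auto simp: NDD_sel)
  have Z: "{0} + A = A" "A + {0} = A" for A :: "('a elt \<Rightarrow> real) set"
    by (simp_all add: set_plus_image image_def)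
  show "Map NDD ({} \<^bold>+ N) N (left_unitor N) (Prod_comp NDD {} N (Unit_comp NDD (), \<upsilon>)) = \<upsilon>"
    unfolding NDD_sel using N sub
    by (intro PiE_restrict_eqI[OF \<upsilon>])
      (simp add: pullback_unitor pushforward_unitor pushforward_image_add Z)
  show "Map NDD (N \<^bold>+ {}) N (right_unitor N) (Prod_comp NDD N {} (\<upsilon>, Unit_comp NDD ())) = \<upsilon>"
    unfolding NDD_sel using N sub
    by (intro PiE_restrict_eqI[OF \<upsilon>])
      (simp add: pullback_unitor pushforward_unitor pushforward_image_add Z)
next
  fix N M :: "'a elt set" and \<upsilon> \<rho>
  assume "finite N" "finite M"
  then show "Map NDD (N \<^bold>+ M) (M \<^bold>+ N) (braiding N M) (Prod_comp NDD N M (\<upsilon>, \<rho>)) =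
      Prod_comp NDD M N (\<rho>, \<upsilon>)"
    by (simp add: NDD_sel pullback_braiding pushforward_braiding pushforward_image_add add.commute
        cong: restrict_cong)
qed


section \<open>The transformation\<close>

lemma natural_transformation_superg: "natural_transformation Conc NDD superg"
  unfolding natural_transformation_def
proof (intro conjI allI impI ballI)
  fix N :: "'a elt set"
  show "superg N \<in> Obj Conc N \<rightarrow> Obj NDD N"
    by (auto simp: superg_def NDD_sel superdifferential_def)
next
  fix N M :: "'a elt set" and \<phi> f
  assume fin: "finite N" "finite M" and "\<phi> \<in> N \<rightarrow>\<^sub>E M" and "f \<in> Obj Conc N"
  then have \<phi>: "\<phi> \<in> N \<rightarrow> M" and f: "concave_on \<real>\<^bsup>N\<^esup> f"
    by (auto simp: Conc_sel)
  have "superdifferential M (Map Conc N M \<phi> f) y =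
      pushforward N \<phi> ` superdifferential N f (pullback N \<phi> y)" if "y \<in> \<real>\<^bsup>M\<^esup>" for y
    using superdifferential_pullback[OF fin \<phi> f that] that
    by (simp add: Conc_sel cong: superdifferential_cong)
  then show "superg M (Map Conc N M \<phi> f) = Map NDD N M \<phi> (superg N f)"
    by (simp add: superg_def NDD_sel cong: restrict_cong)
qed (rule is_functor_Conc is_functor_NDD)+

theorem corollary5p6p1:
  shows "monoidal_natural_transformation
           (Conc :: ('a, ('a elt \<Rightarrow> real) \<Rightarrow> real) set_functor)
           (NDD :: ('a, ('a elt \<Rightarrow> real) \<Rightarrow> ('a elt \<Rightarrow> real) set) set_functor)
           superg"
  unfolding monoidal_natural_transformation_def
proof (intro conjI allI impI ballI)
  fix N M :: "'a elt set" and f g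
  assume fin: "finite N" "finite M"
  have "superdifferential (N \<^bold>+ M) (Prod_comp Conc N M (f, g)) z =
      pushforward N (incl_left N) ` superdifferential N f (pullback N (incl_left N) z) +
      pushforward M (incl_right M) ` superdifferential M g (pullback M (incl_right M) z)"
    if "z \<in> \<real>\<^bsup>N \<^bold>+ M\<^esup>" for z
    using superdifferential_coprod[OF fin that, of f g] that
    by (simp add: Conc_sel cong: superdifferential_cong)
  then show "superg (N \<^bold>+ M) (Prod_comp Conc N M (f, g)) = Prod_comp NDD N M (superg N f, superg M g)"
    by (simp add: superg_def NDD_sel cong: restrict_cong)
next
  show "superg {} (Unit_comp Conc ()) = (Unit_comp NDD () :: ('a elt \<Rightarrow> real) \<Rightarrow> ('a elt \<Rightarrow> real) set)"
    by (auto simp: superg_def Conc_sel NDD_sel vec_space_empty superdifferential_def intro!: restrict_ext)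
qed (rule lax_symmetric_monoidal_functor_Conc lax_symmetric_monoidal_functor_NDD
    natural_transformation_superg)+

end
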